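(* Let $d\in\{1,2,3\}$, let $u_0\in\mathrm{C}_b^{2,\gamma}(\mathbb{R}^d;\mathbb{R})$ be nonrandom for some $0<\gamma\le1$, and fix $n\in\mathbb{N}$. Let $u_n^x(t)=\mathbb{E}\left[u_0\left(\mathbb{S}^x_{B,\delta_n}(t)\right)\right]$, where $\mathbb{S}^x_{B,\delta_n}$ is the Brownian-time random walk on $\mathbb{X}_n^d$ started at $x$. Then $u_n$ solves the fourth order differential-difference equation $$\frac{d u_n^x(t)}{dt}=\frac{\Delta_nu_0(x)}{\sqrt{8\pi t}}+\frac18\Delta_n^2u_n^x(t),\quad (t,x)\in(0,\infty)\times\mathbb{X}_n^d;\qquad u_n^x(0)=u_0(x),\quad x\in\mathbb{X}_n^d.$$ Moreover, the BTRW density $\mathbb{K}^{\mathrm{BTRW}^d_{\delta_n}}_{t;x}$ solves the same equation on $[0,\infty)\times\mathbb{X}_n^d$ with the initial function $u_0$ replaced by $$u_0(x)=\mathbb{K}^{\mathrm{BTRW}^d_{\delta_n}}_{0;x}=K^{\mathrm{RW}^d_{\delta_n}}_{0;x}=\begin{cases}1,&x=0,\\0,&x\ne0.\end{cases}$$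
   Context: $\mathrm{C}_b^{2,\gamma}(\mathbb{R}^d;\mathbb{R})$: twice continuously differentiable real functions with bounded derivatives of orders $0,1,2$ and second derivatives H\"older continuous of exponent $\gamma$. $\delta_n>0$; $\mathbb{X}_n^d=\delta_n\mathbb{Z}^d$; $\Delta_nf(x)=\sum_{i=1}^d\delta_n^{-2}[f(x+\delta_ne_i)-2f(x)+f(x-\delta_ne_i)]$ and $\Delta_n^2=\Delta_n\Delta_n$, acting in the variable $x$. $S^x_{\delta_n}$ is the continuous-time symmetric random walk on $\mathbb{X}_n^d$ started at $x$ with generator $\frac12\Delta_n$, with transition density $K^{\mathrm{RW}^d_{\delta_n}}_{t;x,y}$. The Brownian-time random walk (BTRW) is $\mathbb{S}^x_{B,\delta_n}(t)=S^x_{\delta_n}(|B_t|)$, where $B$ is a one-dimensional Brownian motion started at $0$ independent of $S^x_{\delta_n}$; its transition density is $$\mathbb{K}^{\mathrm{BTRW}^d_{\delta_n}}_{t;x,y}=2\int_0^\infty K^{\mathrm{RW}^d_{\delta_n}}_{s;x,y}\frac{e^{-s^2/2t}}{\sqrt{2\pi t}}\,ds,\qquad t>0.$$ A single spatial index means $y=0$: $\mathbb{K}_{t;x}=\mathbb{K}_{t;x,0}$ (same for all densities). *)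

theory Defs
  imports "HOL-Probability.Probability"
begin

section \<open>Lattice, discrete Laplacian, and the function class\<close>

definition scaled_lattice :: "real \<Rightarrow> (real ^ 'd) set" where
  "scaled_lattice \<delta> = {x. \<forall>i. \<exists>k::int. x $ i = \<delta> * of_int k}"

definition discrete_laplacian ::
    "real \<Rightarrow> (real ^ 'd \<Rightarrow> real) \<Rightarrow> real ^ 'd \<Rightarrow> real" where
  "discrete_laplacian \<delta> f x =
     (\<Sum>i\<in>UNIV. (f (x + \<delta> *\<^sub>R axis i 1) - 2 * f x + f (x - \<delta> *\<^sub>R axis i 1)) / \<delta>\<^sup>2)"

text \<open>Here \<open>g\<close> is the gradient and \<open>H\<close> the Hessian matrix of \<open>f\<close>.\<close>

definition C_b_2 :: "real \<Rightarrow> (real ^ 'd \<Rightarrow> real) set" where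
  "C_b_2 \<gamma> = {f. \<exists>(g :: real ^ 'd \<Rightarrow> real ^ 'd) (H :: real ^ 'd \<Rightarrow> real ^ 'd ^ 'd).
     (\<forall>x. (f has_derivative (\<lambda>v. g x \<bullet> v)) (at x)) \<and>
     (\<forall>x. (g has_derivative (\<lambda>v. H x *v v)) (at x)) \<and>
     continuous_on UNIV H \<and>
     bounded (range f) \<and> bounded (range g) \<and> bounded (range H) \<and>
     (\<exists>C. \<forall>x y. norm (H x - H y) \<le> C * dist x y powr \<gamma>)}"

section \<open>Random walk, Brownian motion, and Brownian-time random walk\<close>

text \<open>Stochastic processes are functions of a real time parameter; only times \<open>t \<ge> 0\<close> matter.\<close>

definition process_sigma ::
    "'w measure \<Rightarrow> (real \<Rightarrow> 'w \<Rightarrow> 'a::topological_space) \<Rightarrow> real set \<Rightarrow> 'w measure" where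
  "process_sigma M X T =
     sigma (space M) (\<Union>r\<in>T. {X r -` A \<inter> space M | A. A \<in> sets borel})"

definition cadlag :: "(real \<Rightarrow> 'a::topological_space) \<Rightarrow> bool" where
  "cadlag p \<longleftrightarrow>
     (\<forall>t\<ge>0. continuous (at_right t) p) \<and> (\<forall>t>0. \<exists>l. (p \<longlongrightarrow> l) (at_left t))"

definition transition_operator ::
    "'w measure \<Rightarrow> ('a \<Rightarrow> real \<Rightarrow> 'w \<Rightarrow> 'a) \<Rightarrow> real \<Rightarrow> ('a \<Rightarrow> real) \<Rightarrow> 'a \<Rightarrow> real" where
  "transition_operator M S t f x = (\<integral>\<omega>. f (S x t \<omega>) \<partial>M)"

text \<open>
  \<open>S x\<close> is the walk started at \<open>x\<close>.  The family \<open>(S x)\<^sub>x\<close> is a time-homogeneous Markov family of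
  lattice-valued cadlag processes whose transition semigroup, acting on the bounded functions on
  the lattice with the supremum norm, has the (bounded) generator \<open>1/2\<close> times the discrete
  Laplacian.  The joint law of the walks with different starting points is left unspecified.
  Path properties are required for every sample point, so that sampling a walk at an
  independent random time again gives a random variable without completing the measure.
\<close>

definition symmetric_random_walk ::
    "'w measure \<Rightarrow> real \<Rightarrow> (real ^ 'd \<Rightarrow> real \<Rightarrow> 'w \<Rightarrow> real ^ 'd) \<Rightarrow> bool" where
  "symmetric_random_walk M \<delta> S \<longleftrightarrow>
     (\<forall>x\<in>scaled_lattice \<delta>.
        (\<forall>t\<ge>0. S x t \<in> borel_measurable M) \<and>
        (\<forall>\<omega>\<in>space M. \<forall>t\<ge>0. S x t \<omega> \<in> scaled_lattice \<delta>) \<and>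
        (\<forall>\<omega>\<in>space M. cadlag (\<lambda>t. S x t \<omega>)) \<and>
        (AE \<omega> in M. S x 0 \<omega> = x)) \<and>
     (\<forall>f. bounded (f ` scaled_lattice \<delta>) \<longrightarrow>
        (\<forall>x\<in>scaled_lattice \<delta>. \<forall>s\<ge>0. \<forall>t\<ge>0. AE \<omega> in M.
           real_cond_exp M (process_sigma M (S x) {0..s}) (\<lambda>\<omega>. f (S x (s + t) \<omega>)) \<omega>
             = transition_operator M S t f (S x s \<omega>)) \<and>
        uniform_limit (scaled_lattice \<delta>)
          (\<lambda>t x. (transition_operator M S t f x - f x) / t)
          (\<lambda>x. 1 / 2 * discrete_laplacian \<delta> f x)
          (at_right 0))"

definition brownian_motion :: "'w measure \<Rightarrow> (real \<Rightarrow> 'w \<Rightarrow> real) \<Rightarrow> bool" where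
  "brownian_motion M B \<longleftrightarrow>
     (\<forall>t\<ge>0. B t \<in> borel_measurable M) \<and>
     (AE \<omega> in M. B 0 \<omega> = 0) \<and>
     (AE \<omega> in M. continuous_on {0..} (\<lambda>t. B t \<omega>)) \<and>
     (\<forall>s t. 0 \<le> s \<and> s < t \<longrightarrow>
        distributed M lborel (\<lambda>\<omega>. B t \<omega> - B s \<omega>) (normal_density 0 (sqrt (t - s)))) \<and>
     (\<forall>(\<tau> :: nat \<Rightarrow> real) k. 0 \<le> \<tau> 0 \<and> incseq \<tau> \<longrightarrow>
        prob_space.indep_vars M (\<lambda>_. borel) (\<lambda>i \<omega>. B (\<tau> (Suc i)) \<omega> - B (\<tau> i) \<omega>) {..<k})"

definition independent_processes ::
    "'w measure \<Rightarrow> (real \<Rightarrow> 'w \<Rightarrow> 'a::topological_space) \<Rightarrow>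
     (real \<Rightarrow> 'w \<Rightarrow> 'b::topological_space) \<Rightarrow> bool" where
  "independent_processes M X Y \<longleftrightarrow>
     prob_space.indep_set M (sets (process_sigma M X {0..})) (sets (process_sigma M Y {0..}))"

definition btrw ::
    "('a \<Rightarrow> real \<Rightarrow> 'w \<Rightarrow> 'a) \<Rightarrow> (real \<Rightarrow> 'w \<Rightarrow> real) \<Rightarrow> 'a \<Rightarrow> real \<Rightarrow> 'w \<Rightarrow> 'a" where
  "btrw S B x t \<omega> = S x \<bar>B t \<omega>\<bar> \<omega>"

text \<open>Densities are with respect to counting measure on the lattice.\<close>

definition rw_density ::
    "'w measure \<Rightarrow> ('a \<Rightarrow> real \<Rightarrow> 'w \<Rightarrow> 'a) \<Rightarrow> real \<Rightarrow> 'a \<Rightarrow> 'a \<Rightarrow> real" where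
  "rw_density M S t x y = measure M {\<omega> \<in> space M. S x t \<omega> = y}"

text \<open>
  The integral formula makes sense only for \<open>t > 0\<close>; at \<open>t = 0\<close> the Brownian clock stands at \<open>0\<close>
  and the density is that of the walk at time \<open>0\<close>.
\<close>

definition btrw_density ::
    "'w measure \<Rightarrow> ('a \<Rightarrow> real \<Rightarrow> 'w \<Rightarrow> 'a) \<Rightarrow> real \<Rightarrow> 'a \<Rightarrow> 'a \<Rightarrow> real" where
  "btrw_density M S t x y =
     (if t = 0 then rw_density M S 0 x y
      else 2 * (LBINT s:{0<..}. rw_density M S s x y * (exp (- s\<^sup>2 / (2 * t)) / sqrt (2 * pi * t))))"

section \<open>The fourth order differential-difference equation\<close>

text \<open>
  The equation holds for \<open>t > 0\<close> (its right-hand side is singular at \<open>t = 0\<close>); the initial value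
  is taken at \<open>t = 0\<close> and is attained continuously.
\<close>

definition solves_btrw_equation ::
    "real \<Rightarrow> (real ^ 'd \<Rightarrow> real) \<Rightarrow> (real \<Rightarrow> real ^ 'd \<Rightarrow> real) \<Rightarrow> bool" where
  "solves_btrw_equation \<delta> u\<^sub>0 u \<longleftrightarrow>
     (\<forall>t>0. \<forall>x\<in>scaled_lattice \<delta>.
        ((\<lambda>s. u s x) has_real_derivative
           discrete_laplacian \<delta> u\<^sub>0 x / sqrt (8 * pi * t)
           + 1 / 8 * discrete_laplacian \<delta> (discrete_laplacian \<delta> (u t)) x) (at t)) \<and>
     (\<forall>x\<in>scaled_lattice \<delta>. u 0 x = u\<^sub>0 x \<and> continuous_on {0..} (\<lambda>t. u t x))"

end

theory Submission
  imports Defs "HOL-Real_Asymp.Real_Asymp"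
begin

text \<open>
  Write \<open>P s\<close> for the transition semigroup of the walk. The sup-norm generator hypothesis and the
  semigroup law make \<open>w s = P s f x\<close> twice continuously differentiable on \<open>[0, \<infinity>)\<close> with
  \<open>w' = P s (\<Delta> f) x / 2\<close> and \<open>w'' = P s (\<Delta>\<^sup>2 f) x / 4\<close>, all bounded. Independence and Fubini give
  \<open>u t x = E w(\<bar>B t\<bar>) = E w(\<surd>t \<bar>Z\<bar>)\<close> with \<open>Z\<close> standard normal. Differentiating the last expression
  under the expectation produces \<open>E(\<bar>Z\<bar> w'(\<surd>t \<bar>Z\<bar>)) / (2 \<surd>t)\<close>, and integration by parts against the
  Gaussian density turns this into \<open>w'(0) / \<surd>(2 \<pi> t) + E w''(\<surd>t \<bar>Z\<bar>) / 2\<close>: the boundary term is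
  the singular source and the remainder is \<open>\<Delta>\<^sup>2 u / 8\<close>. The density is the
  case where \<open>f\<close> is the indicator of \<open>0\<close>.
\<close>

section \<open>Gaussian averages of functions on the half-line\<close>

text \<open>This is the mean of \<open>w\<close> at the absolute value of a centred normal variable
  of variance \<open>t\<close>. The density is kept fixed and \<open>t\<close> put into the
  argument, so that differentiation in \<open>t\<close> falls on \<open>w\<close> and the case
  \<open>t = 0\<close> needs no separate formula.\<close>

definition half_normal_mean :: "(real \<Rightarrow> real) \<Rightarrow> real \<Rightarrow> real" where
  "half_normal_mean w t = (\<integral>z. std_normal_density z * w (sqrt t * \<bar>z\<bar>) \<partial>lborel)"

text \<open>Nothing is known about \<open>w\<close> at negative arguments; the absolute value keeps
  the argument in the half-line, so the composite is continuous on the whole line.\<close>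

lemma borel_measurable_half_line_scaled:
  fixes w :: "real \<Rightarrow> real"
  assumes "continuous_on {0..} w" "r \<ge> 0"
  shows "(\<lambda>z. w (r * \<bar>z\<bar>)) \<in> borel_measurable borel"
  by (intro borel_measurable_continuous_onI continuous_on_compose2[OF assms(1)] continuous_intros)
     (use assms(2) in auto)

text \<open>The power \<open>k = 0\<close> serves the averages themselves, \<open>k = 1\<close> the
  factor that appears on differentiating in \<open>r\<close>.\<close>

lemma integrable_std_normal_bounded:
  fixes w :: "real \<Rightarrow> real"
  assumes "continuous_on {0..} w" "\<And>s. s \<ge> 0 \<Longrightarrow> \<bar>w s\<bar> \<le> K" "r \<ge> 0"
  shows "integrable lborel (\<lambda>z. std_normal_density z * \<bar>z\<bar> ^ k * w (r * \<bar>z\<bar>))"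
proof (rule Bochner_Integration.integrable_bound)
  show "integrable lborel (\<lambda>z. std_normal_density z * \<bar>z\<bar> ^ k * K)"
    by (intro integrable_mult_left integrable_std_normal_moment_abs)
  note [measurable] = borel_measurable_half_line_scaled[OF assms(1,3)]
  show "(\<lambda>z. std_normal_density z * \<bar>z\<bar> ^ k * w (r * \<bar>z\<bar>)) \<in> borel_measurable lborel"
    by measurable
  have "\<bar>w (r * \<bar>z\<bar>)\<bar> \<le> \<bar>K\<bar>" for z
    using assms(2)[of "r * \<bar>z\<bar>"] assms(3) by simp
  then show "AE z in lborel. norm (std_normal_density z * \<bar>z\<bar> ^ k * w (r * \<bar>z\<bar>))
      \<le> norm (std_normal_density z * \<bar>z\<bar> ^ k * K)"
    by (auto simp: abs_mult intro!: mult_left_mono)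
qed

text \<open>Dominated convergence along sequences, with \<open>K\<close> times the density as
  majorant. The endpoint \<open>r = 0\<close> is included because it later shows that the initial
  value is attained continuously.\<close>

lemma continuous_on_std_normal_scaled:
  fixes w :: "real \<Rightarrow> real"
  assumes "continuous_on {0..} w" "\<And>s. s \<ge> 0 \<Longrightarrow> \<bar>w s\<bar> \<le> K"
  shows "continuous_on {0..} (\<lambda>r. \<integral>z. std_normal_density z * w (r * \<bar>z\<bar>) \<partial>lborel)"
proof (subst continuous_on_sequentially, intro allI impI ballI, elim conjE)
  fix X :: "nat \<Rightarrow> real" and r
  assume r: "r \<in> {0..}" and X: "\<forall>n. X n \<in> {0..}" "X \<longlonglongrightarrow> r"
  have Xn: "X n \<ge> 0" for n using X by auto
  have r0: "r \<ge> 0" using r by simp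
  note meas[measurable] = borel_measurable_half_line_scaled[OF assms(1)]
  show "((\<lambda>r. \<integral>z. std_normal_density z * w (r * \<bar>z\<bar>) \<partial>lborel) \<circ> X) \<longlonglongrightarrow>
      (\<integral>z. std_normal_density z * w (r * \<bar>z\<bar>) \<partial>lborel)"
    unfolding o_def
  proof (rule integral_dominated_convergence)
    show "(\<lambda>z. std_normal_density z * w (r * \<bar>z\<bar>)) \<in> borel_measurable lborel"
      using meas[OF r0] by simp
    show "(\<lambda>z. std_normal_density z * w (X n * \<bar>z\<bar>)) \<in> borel_measurable lborel" for n
      using meas[OF Xn] by simp
    show "integrable lborel (\<lambda>z. std_normal_density z * K)"
      using integrable_std_normal_moment_abs[of 0] by simp
    have "(\<lambda>n. w (X n * \<bar>z\<bar>)) \<longlonglongrightarrow> w (r * \<bar>z\<bar>)" for z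
      by (rule continuous_on_tendsto_compose[OF assms(1)])
         (use X r0 Xn in \<open>auto intro!: tendsto_intros\<close>)
    then show "AE z in lborel. (\<lambda>n. std_normal_density z * w (X n * \<bar>z\<bar>)) \<longlonglongrightarrow>
        std_normal_density z * w (r * \<bar>z\<bar>)"
      by (intro AE_I2 tendsto_intros)
    show "AE z in lborel. norm (std_normal_density z * w (X n * \<bar>z\<bar>)) \<le> std_normal_density z * K" for n
      using assms(2) Xn by (auto simp: abs_mult intro!: mult_left_mono)
  qed
qed

text \<open>By the mean value inequality the difference quotients in \<open>r\<close> are at most
  \<open>K' * \<bar>z\<bar>\<close>, which is integrable against the Gaussian density, so the limit
  passes under the integral.\<close>

lemma has_real_derivative_std_normal_scaled:
  fixes w w' :: "real \<Rightarrow> real"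
  assumes deriv: "\<And>s. s \<ge> 0 \<Longrightarrow> (w has_real_derivative w' s) (at s within {0..})"
    and cont': "continuous_on {0..} w'"
    and bd: "\<And>s. s \<ge> 0 \<Longrightarrow> \<bar>w s\<bar> \<le> K" and bd': "\<And>s. s \<ge> 0 \<Longrightarrow> \<bar>w' s\<bar> \<le> K'"
    and r: "r > 0"
  shows "((\<lambda>r. \<integral>z. std_normal_density z * w (r * \<bar>z\<bar>) \<partial>lborel) has_real_derivative
     (\<integral>z. std_normal_density z * \<bar>z\<bar> * w' (r * \<bar>z\<bar>) \<partial>lborel)) (at r)"
proof -
  let ?I = "\<lambda>r. \<integral>z. std_normal_density z * w (r * \<bar>z\<bar>) \<partial>lborel"
  let ?D = "\<integral>z. std_normal_density z * \<bar>z\<bar> * w' (r * \<bar>z\<bar>) \<partial>lborel"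
  have cont: "continuous_on {0..} w"
    using deriv by (auto simp: continuous_on_eq_continuous_within intro: DERIV_continuous)
  note meas = borel_measurable_half_line_scaled[OF cont] borel_measurable_half_line_scaled[OF cont']
  have lip: "\<bar>w b - w a\<bar> \<le> K' * \<bar>b - a\<bar>" if "a \<ge> 0" "b \<ge> 0" for a b
    using field_differentiable_bound[of "{0::real..}" w w' K' b a] deriv bd' that by auto
  have D0: "(w has_real_derivative w' s) (at s)" if "s > 0" for s
    using deriv[of s] that at_within_interior[of s "{0..}"] by simp
  \<comment> \<open>Increments stay inside \<open>{0..}\<close>, where \<open>w\<close> is
    controlled; as \<open>r\<close> is an interior point this yields the full derivative at the
    end.\<close>
  have "((\<lambda>q. (?I q - ?I r) / (q - r)) \<longlongrightarrow> ?D) (at r within {0..})"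
  proof (subst tendsto_at_iff_sequentially, intro allI impI)
    fix X :: "nat \<Rightarrow> real" assume X: "\<forall>i. X i \<in> {0..} - {r}" "X \<longlonglongrightarrow> r"
    have X0: "X n \<ge> 0" and Xr: "X n \<noteq> r" for n using X by auto
    have int: "integrable lborel (\<lambda>z. std_normal_density z * w (q * \<bar>z\<bar>))" if "q \<ge> 0" for q
      using integrable_std_normal_bounded[OF cont bd that, of 0] by simp
    have eq: "(?I (X n) - ?I r) / (X n - r) =
       (\<integral>z. std_normal_density z * ((w (X n * \<bar>z\<bar>) - w (r * \<bar>z\<bar>)) / (X n - r)) \<partial>lborel)" for n
    proof -
      have "?I (X n) - ?I r =
          (\<integral>z. std_normal_density z * w (X n * \<bar>z\<bar>) - std_normal_density z * w (r * \<bar>z\<bar>) \<partial>lborel)"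
        using int X0 r by simp
      then have "(?I (X n) - ?I r) / (X n - r) = (\<integral>z. (std_normal_density z * w (X n * \<bar>z\<bar>)
          - std_normal_density z * w (r * \<bar>z\<bar>)) / (X n - r) \<partial>lborel)"
        by simp
      then show ?thesis by (simp add: right_diff_distrib)
    qed
    show "((\<lambda>q. (?I q - ?I r) / (q - r)) \<circ> X) \<longlonglongrightarrow> ?D"
      unfolding o_def eq
    proof (rule integral_dominated_convergence)
      show "(\<lambda>z. std_normal_density z * \<bar>z\<bar> * w' (r * \<bar>z\<bar>)) \<in> borel_measurable lborel"
        using meas(2)[of r] r by simp
      show "(\<lambda>z. std_normal_density z * ((w (X n * \<bar>z\<bar>) - w (r * \<bar>z\<bar>)) / (X n - r)))
          \<in> borel_measurable lborel" for n
        using meas(1)[of r] meas(1)[OF X0] r by simp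
      show "integrable lborel (\<lambda>z. std_normal_density z * \<bar>z\<bar> * K')"
        using integrable_std_normal_moment_abs[of 1] by simp
      have lim: "(\<lambda>n. (w (X n * \<bar>z\<bar>) - w (r * \<bar>z\<bar>)) / (X n - r)) \<longlonglongrightarrow> \<bar>z\<bar> * w' (r * \<bar>z\<bar>)" for z
      \<comment> \<open>For \<open>z \<noteq> 0\<close> the point \<open>r * \<bar>z\<bar>\<close>
        is interior and the two-sided derivative of \<open>w\<close> applies; for
        \<open>z = 0\<close> both sides vanish.\<close>
      proof (cases "z = 0")
        case False
        have "((\<lambda>q. w (q * \<bar>z\<bar>)) has_real_derivative w' (r * \<bar>z\<bar>) * \<bar>z\<bar>) (at r)"
          by (rule DERIV_chain2[OF D0]) (use r False in \<open>auto intro!: derivative_eq_intros\<close>)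
        then have "((\<lambda>q. (w (q * \<bar>z\<bar>) - w (r * \<bar>z\<bar>)) / (q - r)) \<longlongrightarrow> w' (r * \<bar>z\<bar>) * \<bar>z\<bar>) (at r)"
          by (simp add: has_field_derivative_iff)
        then show ?thesis
          using X Xr by (auto simp: tendsto_at_iff_sequentially o_def mult.commute[of "w' _"])
      qed simp
      then show "AE z in lborel. (\<lambda>n. std_normal_density z * ((w (X n * \<bar>z\<bar>) - w (r * \<bar>z\<bar>)) / (X n - r)))
          \<longlonglongrightarrow> std_normal_density z * \<bar>z\<bar> * w' (r * \<bar>z\<bar>)"
        unfolding mult.assoc by (intro AE_I2 tendsto_mult_left)
      have "\<bar>(w (X n * \<bar>z\<bar>) - w (r * \<bar>z\<bar>)) / (X n - r)\<bar> \<le> \<bar>z\<bar> * K'" for n z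
      proof -
        have "\<bar>w (X n * \<bar>z\<bar>) - w (r * \<bar>z\<bar>)\<bar> \<le> K' * \<bar>X n * \<bar>z\<bar> - r * \<bar>z\<bar>\<bar>"
          by (intro lip) (use X0 r in auto)
        also have "\<bar>X n * \<bar>z\<bar> - r * \<bar>z\<bar>\<bar> = \<bar>X n - r\<bar> * \<bar>z\<bar>"
          by (metis abs_mult abs_abs left_diff_distrib)
        finally show ?thesis
          using Xr[of n] by (simp add: divide_simps ac_simps)
      qed
      then show "AE z in lborel. norm (std_normal_density z * ((w (X n * \<bar>z\<bar>) - w (r * \<bar>z\<bar>)) / (X n - r)))
          \<le> std_normal_density z * \<bar>z\<bar> * K'" for n
        by (intro AE_I2) (simp only: real_norm_def abs_mult mult.assoc abs_of_nonneg[OF normal_density_nonneg], intro mult_left_mono, auto)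
    qed
  qed
  moreover have "at r within {0..} = at r"
    using r by (intro at_within_interior) simp
  ultimately show ?thesis by (simp add: has_field_derivative_iff)
qed

section \<open>Gaussian integration by parts\<close>

lemma integral_even_eq_half_line:
  fixes f :: "real \<Rightarrow> real"
  assumes "set_integrable lborel {0<..} f" "\<And>x. f (- x) = f x"
    and [measurable]: "f \<in> borel_measurable borel"
  shows "integral\<^sup>L lborel f = 2 * (LBINT x:{0<..}. f x)"
proof -
  \<comment> \<open>The rule for even functions speaks of the closed half-line; the two half-lines
    differ by a null set.\<close>
  have ae: "AE x in lborel. indicator {0<..} x *\<^sub>R f x = indicator {0..} x *\<^sub>R f x"
    using AE_lborel_singleton[of "0::real"] by eventually_elim (auto simp: indicator_def)
  have "has_bochner_integral lborel (\<lambda>x. indicator {0<..} x *\<^sub>R f x) (LBINT x:{0<..}. f x)"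
    using assms(1) unfolding set_integrable_def set_lebesgue_integral_def
    by (simp add: has_bochner_integral_integrable)
  then have "has_bochner_integral lborel (\<lambda>x. indicator {0..} x *\<^sub>R f x) (LBINT x:{0<..}. f x)"
    by (rule has_bochner_integralI_AE[OF _ _ ae]) measurable
  from has_bochner_integral_even_function[OF this assms(2)] show ?thesis
    by (simp add: has_bochner_integral_integral_eq)
qed

lemma std_normal_density_deriv:
  "(std_normal_density has_real_derivative - z * std_normal_density z) (at z)"
  unfolding std_normal_density_def
  by (auto intro!: derivative_eq_intros simp: field_simps)

lemma tendsto_std_normal_density_at_top: "(std_normal_density \<longlongrightarrow> 0) at_top"
  unfolding std_normal_density_def
  by real_asymp

text \<open>The Gaussian density satisfies \<open>\<phi>' z = - z * \<phi> z\<close>, so for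
  \<open>z > 0\<close> the difference of the two integrands is the derivative of
  \<open>- \<phi> z * w (r * z)\<close>. Its value at \<open>0\<close> gives the boundary term,
  doubled because the integrand is even and both half-lines contribute.\<close>

lemma integral_std_normal_by_parts:
  fixes w w' :: "real \<Rightarrow> real"
  assumes deriv: "\<And>s. s \<ge> 0 \<Longrightarrow> (w has_real_derivative w' s) (at s within {0..})"
    and cont': "continuous_on {0..} w'"
    and bd: "\<And>s. s \<ge> 0 \<Longrightarrow> \<bar>w s\<bar> \<le> K" and bd': "\<And>s. s \<ge> 0 \<Longrightarrow> \<bar>w' s\<bar> \<le> K'"
    and r: "r > 0"
  shows "(\<integral>z. std_normal_density z * \<bar>z\<bar> * w (r * \<bar>z\<bar>) \<partial>lborel)
     = 2 * w 0 / sqrt (2 * pi) + r * (\<integral>z. std_normal_density z * w' (r * \<bar>z\<bar>) \<partial>lborel)"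
proof -
  have cont: "continuous_on {0..} w"
    using deriv by (auto simp: continuous_on_eq_continuous_within intro: DERIV_continuous)
  have D0: "(w has_real_derivative w' s) (at s)" if "s > 0" for s
    using deriv[of s] that at_within_interior[of s "{0..}"] by simp
  define f where "f z = std_normal_density z * \<bar>z\<bar> * w (r * \<bar>z\<bar>) - r * (std_normal_density z * w' (r * \<bar>z\<bar>))" for z
  have i1: "integrable lborel (\<lambda>z. std_normal_density z * \<bar>z\<bar> * w (r * \<bar>z\<bar>))"
    using integrable_std_normal_bounded[OF cont bd, of r 1] r by simp
  have i2: "integrable lborel (\<lambda>z. std_normal_density z * w' (r * \<bar>z\<bar>))"
    using integrable_std_normal_bounded[OF cont' bd', of r 0] r by simp
  have fi: "integrable lborel f"
    unfolding f_def using i1 i2 by simp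
  have sfi: "set_integrable lborel {0<..} f"
    unfolding set_integrable_def by (intro integrable_mult_indicator fi) auto
  let ?F = "\<lambda>z. - (std_normal_density z * w (r * z))"
  \<comment> \<open>The \<open>0\<close> on the right is the limit of \<open>?F\<close> at infinity,
    where the density decays and \<open>w\<close> is bounded.\<close>
  have "(LBINT z=ereal 0..\<infinity>. f z) = 0 - ?F 0"
  proof (rule interval_integral_FTC_integrable)
    fix z assume "ereal 0 < ereal z"
    then have z: "z > 0" by simp
    have "((\<lambda>z. w (r * z)) has_real_derivative w' (r * z) * r) (at z)"
      by (rule DERIV_chain2[OF D0]) (use r z in \<open>auto intro!: derivative_eq_intros\<close>)
    then have "(?F has_real_derivative f z) (at z)"
      unfolding f_def
      by (auto intro!: derivative_eq_intros std_normal_density_deriv simp: z less_imp_le algebra_simps)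
    then show "(?F has_vector_derivative f z) (at z)"
      by (simp add: has_real_derivative_iff_has_vector_derivative)
    have "continuous_on {0<..} f"
      unfolding f_def normal_density_def
      by (intro continuous_intros continuous_on_compose2[OF cont] continuous_on_compose2[OF cont'])
         (use r in auto)
    then show "isCont f z" using z by (simp add: continuous_on_eq_continuous_at)
  next
    show "set_integrable lborel (einterval (ereal 0) \<infinity>) f"
      using sfi by simp
    have "continuous_on {0..} ?F"
      unfolding normal_density_def
      by (intro continuous_intros continuous_on_compose2[OF cont])  (use r in auto)
    then have "(?F \<longlongrightarrow> ?F 0) (at_right 0)"
      unfolding continuous_on_def by (intro tendsto_within_subset[where T = "{0<..}" and S = "{0..}"]) force+
    then show "((?F \<circ> real_of_ereal) \<longlongrightarrow> ?F 0) (at_right (ereal 0))"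
      unfolding ereal_tendsto_simps .
    have "(?F \<longlongrightarrow> 0) at_top"
    proof (rule Lim_null_comparison)
      show "\<forall>\<^sub>F z in at_top. norm (?F z) \<le> std_normal_density z * K"
        using eventually_ge_at_top[of 0]
        by eventually_elim (use bd r in \<open>auto simp: abs_mult intro!: mult_left_mono\<close>)
      show "((\<lambda>z. std_normal_density z * K) \<longlongrightarrow> 0) at_top"
        using tendsto_mult_left_zero[OF tendsto_std_normal_density_at_top] .
    qed
    then show "((?F \<circ> real_of_ereal) \<longlongrightarrow> 0) (at_left \<infinity>)"
      unfolding ereal_tendsto_simps .
  qed simp
  then have "(LBINT z:{0<..}. f z) = std_normal_density 0 * w 0"
    by (simp add: interval_integral_to_infinity_eq)
  then have "integral\<^sup>L lborel f = 2 * (std_normal_density 0 * w 0)"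
    using integral_even_eq_half_line[OF sfi] borel_measurable_integrable[OF fi]
    by (simp add: f_def normal_density_def)
  moreover have "integral\<^sup>L lborel f = (\<integral>z. std_normal_density z * \<bar>z\<bar> * w (r * \<bar>z\<bar>) \<partial>lborel)
      - r * (\<integral>z. std_normal_density z * w' (r * \<bar>z\<bar>) \<partial>lborel)"
    unfolding f_def using i1 i2 by simp
  ultimately show ?thesis
    by (simp add: std_normal_density_def)
qed

section \<open>Continuity, derivative and density forms of the half-normal mean\<close>

lemma continuous_on_half_normal_mean:
  assumes "continuous_on {0..} w" "\<And>s. s \<ge> 0 \<Longrightarrow> \<bar>w s\<bar> \<le> K"
  shows "continuous_on {0..} (half_normal_mean w)"
  unfolding half_normal_mean_def
  by (rule continuous_on_compose2[OF continuous_on_std_normal_scaled[OF assms]])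
     (auto intro: continuous_intros)

lemma half_normal_mean_0: "half_normal_mean w 0 = w 0"
  using integral_std_normal_moment_even[of 0] by (simp add: half_normal_mean_def)

lemma has_real_derivative_half_normal_mean:
  fixes w w' w'' :: "real \<Rightarrow> real"
  assumes w: "\<And>s. s \<ge> 0 \<Longrightarrow> (w has_real_derivative w' s) (at s within {0..})"
    and w': "\<And>s. s \<ge> 0 \<Longrightarrow> (w' has_real_derivative w'' s) (at s within {0..})"
    and cont: "continuous_on {0..} w''"
    and bd: "\<And>s. s \<ge> 0 \<Longrightarrow> \<bar>w s\<bar> \<le> K" "\<And>s. s \<ge> 0 \<Longrightarrow> \<bar>w' s\<bar> \<le> K'"
      "\<And>s. s \<ge> 0 \<Longrightarrow> \<bar>w'' s\<bar> \<le> K''"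
    and t: "t > 0"
  shows "(half_normal_mean w has_real_derivative
     w' 0 / sqrt (2 * pi * t) + half_normal_mean w'' t / 2) (at t)"
proof -
  have cont': "continuous_on {0..} w'"
    using w' by (auto simp: continuous_on_eq_continuous_within intro: DERIV_continuous)
  let ?I = "\<integral>z. std_normal_density z * \<bar>z\<bar> * w' (sqrt t * \<bar>z\<bar>) \<partial>lborel"
  have sqrt_t: "sqrt t > 0" using t by simp
  have "(half_normal_mean w has_real_derivative ?I * (inverse (sqrt t) / 2)) (at t)"
    unfolding half_normal_mean_def
    by (rule DERIV_chain2[OF has_real_derivative_std_normal_scaled[OF w cont' bd(1,2) sqrt_t]
          DERIV_real_sqrt[OF t]])
  \<comment> \<open>Integration by parts is applied to the pair \<open>w'\<close>,
    \<open>w''\<close>. Its factor \<open>sqrt t\<close> cancels the \<open>1 / sqrt t\<close> of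
    the chain rule in front of the mean of \<open>w''\<close>, so only the boundary term keeps a
    singular factor.\<close>
  moreover have "?I = 2 * w' 0 / sqrt (2 * pi) + sqrt t * half_normal_mean w'' t"
    unfolding half_normal_mean_def by (rule integral_std_normal_by_parts[OF w' cont bd(2,3) sqrt_t])
  then have "?I * (inverse (sqrt t) / 2) = w' 0 / sqrt (2 * pi * t) + half_normal_mean w'' t / 2"
    using t by (simp add: field_simps real_sqrt_mult)
  ultimately show ?thesis by (simp only:)
qed

text \<open>The substitution \<open>s = sqrt t * z\<close>; this form matches the law of a Brownian
  increment.\<close>

lemma half_normal_mean_eq_integral_normal_density:
  assumes "t > 0"
  shows "half_normal_mean w t = (\<integral>s. normal_density 0 (sqrt t) s * w \<bar>s\<bar> \<partial>lborel)"
proof -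
  have "(\<integral>s. normal_density 0 (sqrt t) s * w \<bar>s\<bar> \<partial>lborel)
      = sqrt t * (\<integral>z. normal_density 0 (sqrt t) (sqrt t * z) * w \<bar>sqrt t * z\<bar> \<partial>lborel)"
    using lborel_integral_real_affine[of "sqrt t" "\<lambda>s. normal_density 0 (sqrt t) s * w \<bar>s\<bar>" 0] assms
    by simp
  also have "\<dots> = (\<integral>z. sqrt t * (normal_density 0 (sqrt t) (sqrt t * z) * w \<bar>sqrt t * z\<bar>) \<partial>lborel)"
    by simp
  also have "\<dots> = half_normal_mean w t"
    unfolding half_normal_mean_def
    using assms by (intro Bochner_Integration.integral_cong)
      (auto simp: normal_density_def power_mult_distrib real_sqrt_mult abs_mult field_simps)
  finally show ?thesis by simp
qed

text \<open>Folding the even integrand onto the positive half-line produces the kernel in the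
  definition of \<open>btrw_density\<close>.\<close>

lemma half_normal_mean_eq_half_line:
  fixes w :: "real \<Rightarrow> real"
  assumes "continuous_on {0..} w" "\<And>s. s \<ge> 0 \<Longrightarrow> \<bar>w s\<bar> \<le> K" "t > 0"
  shows "half_normal_mean w t
    = 2 * (LBINT s:{0<..}. w s * (exp (- s\<^sup>2 / (2 * t)) / sqrt (2 * pi * t)))"
proof -
  let ?f = "\<lambda>s. normal_density 0 (sqrt t) s * w \<bar>s\<bar>"
  have meas [measurable]: "(\<lambda>s. w \<bar>s\<bar>) \<in> borel_measurable borel"
    using borel_measurable_half_line_scaled[OF assms(1), of 1] by simp
  have int: "integrable lborel ?f"
  proof (rule Bochner_Integration.integrable_bound)
    show "integrable lborel (\<lambda>s. normal_density 0 (sqrt t) s * K)"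
      using assms(3) integrable_normal_moment[of "sqrt t" 0 0] by simp
    show "AE s in lborel. norm (?f s) \<le> norm (normal_density 0 (sqrt t) s * K)"
      using assms(2) by (auto simp: abs_mult intro!: mult_left_mono order.trans[OF _ abs_ge_self])
  qed simp
  have "set_integrable lborel {0<..} ?f"
    unfolding set_integrable_def by (intro integrable_mult_indicator int) auto
  then have "integral\<^sup>L lborel ?f = 2 * (LBINT s:{0<..}. ?f s)"
    by (rule integral_even_eq_half_line) (simp_all add: normal_density_def)
  also have "(LBINT s:{0<..}. ?f s) = (LBINT s:{0<..}. w s * (exp (- s\<^sup>2 / (2 * t)) / sqrt (2 * pi * t)))"
    using assms(3) by (intro set_lebesgue_integral_cong) (auto simp: normal_density_def)
  finally show ?thesis
    using half_normal_mean_eq_integral_normal_density[OF assms(3)] by simp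
qed

section \<open>The discrete Laplacian on the lattice\<close>

lemma countable_scaled_lattice: "countable (scaled_lattice \<delta> :: (real ^ 'd) set)"
proof -
  have "scaled_lattice \<delta> \<subseteq> range (\<lambda>k :: 'd \<Rightarrow> int. \<chi> i. \<delta> * of_int (k i))"
  proof
    fix x :: "real ^ 'd" assume "x \<in> scaled_lattice \<delta>"
    then obtain k :: "'d \<Rightarrow> int" where "x $ i = \<delta> * of_int (k i)" for i
      unfolding scaled_lattice_def by (simp, metis)
    then have "x = (\<chi> i. \<delta> * of_int (k i))" by (simp add: vec_eq_iff)
    then show "x \<in> range (\<lambda>k :: 'd \<Rightarrow> int. \<chi> i. \<delta> * of_int (k i))" by blast
  qed
  then show ?thesis by (rule countable_subset) simp
qed

lemma scaled_lattice_step: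
  assumes "x \<in> scaled_lattice \<delta>"
  shows "x + \<delta> *\<^sub>R axis i 1 \<in> scaled_lattice \<delta>" "x - \<delta> *\<^sub>R axis i 1 \<in> scaled_lattice \<delta>"
proof -
  have "\<exists>k::int. (x + \<delta> *\<^sub>R axis i 1) $ j = \<delta> * of_int k" "\<exists>k::int. (x - \<delta> *\<^sub>R axis i 1) $ j = \<delta> * of_int k" for j
  proof -
    obtain k :: int where k: "x $ j = \<delta> * of_int k"
      using assms by (auto simp: scaled_lattice_def)
    show "\<exists>k::int. (x + \<delta> *\<^sub>R axis i 1) $ j = \<delta> * of_int k"
      by (rule exI[of _ "if i = j then k + 1 else k"]) (simp add: k axis_def algebra_simps)
    show "\<exists>k::int. (x - \<delta> *\<^sub>R axis i 1) $ j = \<delta> * of_int k"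
      by (rule exI[of _ "if i = j then k - 1 else k"]) (simp add: k axis_def algebra_simps)
  qed
  then show "x + \<delta> *\<^sub>R axis i 1 \<in> scaled_lattice \<delta>" "x - \<delta> *\<^sub>R axis i 1 \<in> scaled_lattice \<delta>"
    by (auto simp: scaled_lattice_def)
qed

text \<open>The stencil of a lattice point stays in the lattice. This permits rewriting under the
  Laplacian with formulas that are valid only at lattice points.\<close>

lemma discrete_laplacian_cong:
  assumes "\<And>y. y \<in> scaled_lattice \<delta> \<Longrightarrow> f y = g y" "x \<in> scaled_lattice \<delta>"
  shows "discrete_laplacian \<delta> f x = discrete_laplacian \<delta> g x"
  unfolding discrete_laplacian_def using assms by (simp add: scaled_lattice_step)

text \<open>Each coordinate contributes at most \<open>4 * K / \<delta>\<^sup>2\<close>. The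
  generator hypothesis covers all functions bounded on the lattice, so it can be applied again to
  the Laplacian of such a function and to its square.\<close>

lemma bounded_discrete_laplacian:
  fixes f :: "real ^ 'd \<Rightarrow> real"
  assumes "bounded (f ` scaled_lattice \<delta>)"
  shows "bounded (discrete_laplacian \<delta> f ` scaled_lattice \<delta>)"
proof -
  obtain K where K: "\<And>x. x \<in> scaled_lattice \<delta> \<Longrightarrow> \<bar>f x\<bar> \<le> K"
    using assms by (auto simp: bounded_iff)
  have "\<bar>discrete_laplacian \<delta> f x\<bar> \<le> (\<Sum>i\<in>(UNIV :: 'd set). 4 * K / \<delta>\<^sup>2)" if x: "x \<in> scaled_lattice \<delta>" for x
    unfolding discrete_laplacian_def
  proof (rule order.trans[OF sum_abs], rule sum_mono)
    fix i :: 'd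
    have "\<bar>f (x + \<delta> *\<^sub>R axis i 1) - 2 * f x + f (x - \<delta> *\<^sub>R axis i 1)\<bar> \<le> 4 * K"
      using K[OF x] K[OF scaled_lattice_step(1)[OF x, of i]] K[OF scaled_lattice_step(2)[OF x, of i]]
      by linarith
    then show "\<bar>(f (x + \<delta> *\<^sub>R axis i 1) - 2 * f x + f (x - \<delta> *\<^sub>R axis i 1)) / \<delta>\<^sup>2\<bar> \<le> 4 * K / \<delta>\<^sup>2"
      by (simp add: abs_divide divide_right_mono)
  qed
  then show ?thesis by (auto simp: bounded_iff)
qed

section \<open>Independence and the Brownian clock\<close>

lemma space_process_sigma [simp]: "space (process_sigma M X T) = space M"
  unfolding process_sigma_def by (rule space_measure_of) auto

lemma sets_process_sigma:
  "sets (process_sigma M X T) =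
     sigma_sets (space M) (\<Union>r\<in>T. {X r -` A \<inter> space M | A. A \<in> sets borel})"
  unfolding process_sigma_def by (rule sets_measure_of) auto

lemma subalgebra_process_sigma:
  assumes "\<And>r. r \<in> T \<Longrightarrow> X r \<in> borel_measurable M"
  shows "subalgebra M (process_sigma M X T)"
  unfolding subalgebra_def sets_process_sigma
  using assms by (auto intro!: sets.sigma_sets_subset)

lemma measurable_process_sigma:
  "r \<in> T \<Longrightarrow> X r \<in> measurable (process_sigma M X T) borel"
  by (rule measurableI) (auto simp: sets_process_sigma intro!: sigma_sets.Basic)

lemma measurable_ident_subalgebra: "subalgebra M F \<Longrightarrow> (\<lambda>\<omega>. \<omega>) \<in> measurable M F"
  by (auto simp: subalgebra_def intro!: measurableI)

text \<open>Independence in the form needed for Fubini. The identity map into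
  \<open>process_sigma M X {0..}\<close> restricts \<open>M\<close> to the events of
  \<open>X\<close>; jointly with \<open>Y t\<close> its law is a product, since independence gives
  the product formula on rectangles.\<close>

lemma pair_measure_distr_process_sigma:
  assumes M: "prob_space M" and ind: "independent_processes M X Y" and t: "t \<ge> 0"
    and X: "\<And>r. r \<ge> 0 \<Longrightarrow> X r \<in> borel_measurable M"
    and Y: "Y t \<in> borel_measurable M"
  shows "distr M borel (Y t) \<Otimes>\<^sub>M distr M (process_sigma M X {0..}) (\<lambda>\<omega>. \<omega>)
    = distr M (borel \<Otimes>\<^sub>M process_sigma M X {0..}) (\<lambda>\<omega>. (Y t \<omega>, \<omega>))"
proof -
  interpret prob_space M by fact
  let ?F = "process_sigma M X {0..}" and ?G = "process_sigma M Y {0..}"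
  have id: "(\<lambda>\<omega>. \<omega>) \<in> measurable M ?F"
    using X by (intro measurable_ident_subalgebra subalgebra_process_sigma) auto
  have pair: "(\<lambda>\<omega>. (Y t \<omega>, \<omega>)) \<in> measurable M (borel \<Otimes>\<^sub>M ?F)"
    using Y id by (rule measurable_Pair)
  interpret D: prob_space "distr M borel (Y t)" by (rule prob_space_distr[OF Y])
  interpret E: prob_space "distr M ?F (\<lambda>\<omega>. \<omega>)" by (rule prob_space_distr[OF id])
  show ?thesis
  proof (rule pair_measure_eqI)
    fix A C assume "A \<in> sets (distr M borel (Y t))" "C \<in> sets (distr M ?F (\<lambda>\<omega>. \<omega>))"
    then have A: "A \<in> sets borel" and C: "C \<in> sets ?F" by simp_all
    have C': "C \<inter> space M = C"
      using sets.sets_into_space[OF C] by auto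
    have YA: "Y t -` A \<inter> space M \<in> sets ?G"
      using measurable_sets[OF measurable_process_sigma[of t "{0..}" Y M] A] t by simp
    have "indep_set (sets ?F) (sets ?G)"
      using ind by (simp add: independent_processes_def)
    then have "prob (C \<inter> (Y t -` A \<inter> space M)) = prob C * prob (Y t -` A \<inter> space M)"
      using C YA by (rule indep_setD)
    then have "ennreal (prob (C \<inter> (Y t -` A \<inter> space M)))
        = ennreal (prob (Y t -` A \<inter> space M)) * ennreal (prob C)"
      by (simp add: ennreal_mult mult.commute)
    then have "emeasure M (Y t -` A \<inter> space M) * emeasure M C = emeasure M (C \<inter> (Y t -` A \<inter> space M))"
      by (simp add: emeasure_eq_measure)
    moreover have "emeasure (distr M borel (Y t)) A = emeasure M (Y t -` A \<inter> space M)"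
      by (rule emeasure_distr[OF Y A])
    moreover have "emeasure (distr M ?F (\<lambda>\<omega>. \<omega>)) C = emeasure M C"
      using emeasure_distr[OF id C] by (simp add: C')
    moreover have "emeasure (distr M (borel \<Otimes>\<^sub>M ?F) (\<lambda>\<omega>. (Y t \<omega>, \<omega>))) (A \<times> C)
        = emeasure M (C \<inter> (Y t -` A \<inter> space M))"
      by (subst emeasure_distr[OF pair pair_measureI[OF A C]]) (rule arg_cong[where f = "emeasure M"], auto)
    ultimately show "emeasure (distr M borel (Y t)) A * emeasure (distr M ?F (\<lambda>\<omega>. \<omega>)) C
        = emeasure (distr M (borel \<Otimes>\<^sub>M ?F) (\<lambda>\<omega>. (Y t \<omega>, \<omega>))) (A \<times> C)"
      by simp
  next
    show "sets (distr M borel (Y t) \<Otimes>\<^sub>M distr M ?F (\<lambda>\<omega>. \<omega>))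
        = sets (distr M (borel \<Otimes>\<^sub>M ?F) (\<lambda>\<omega>. (Y t \<omega>, \<omega>)))"
      unfolding sets_distr by (rule sets_pair_measure_cong) simp_all
  qed (fact D.sigma_finite_measure_axioms E.sigma_finite_measure_axioms)+
qed

lemma brownian_motion_expectation_abs:
  fixes w :: "real \<Rightarrow> real"
  assumes M: "prob_space M" and B: "brownian_motion M B"
    and w: "continuous_on {0..} w" and t: "t \<ge> 0"
  shows "(\<integral>\<omega>. w \<bar>B t \<omega>\<bar> \<partial>M) = half_normal_mean w t"
proof -
  interpret prob_space M by fact
  have meas: "B r \<in> borel_measurable M" if "r \<ge> 0" for r
    using B that by (simp add: brownian_motion_def)
  have B0: "AE \<omega> in M. B 0 \<omega> = 0"
    using B by (simp add: brownian_motion_def)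
  have w_meas: "(\<lambda>s. w \<bar>s\<bar>) \<in> borel_measurable borel"
    using borel_measurable_half_line_scaled[OF w, of 1] by simp
  note comp = measurable_compose[OF _ w_meas]
  show ?thesis
  proof (cases "t = 0")
    case True
    have "(\<integral>\<omega>. w \<bar>B 0 \<omega>\<bar> \<partial>M) = (\<integral>\<omega>. w 0 \<partial>M)"
    proof (rule integral_cong_AE)
      show "AE \<omega> in M. w \<bar>B 0 \<omega>\<bar> = w 0" using B0 by eventually_elim simp
    qed (simp_all add: comp meas)
    then show ?thesis by (simp add: True half_normal_mean_0 prob_space)
  next
    case False
    with t have t: "t > 0" by simp
    \<comment> \<open>The definition prescribes the law of increments only, so the law of
      \<open>B t\<close> comes from the increment over \<open>[0, t]\<close> together with
      \<open>B 0 = 0\<close> almost surely.\<close>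
    have "\<forall>r s. 0 \<le> r \<and> r < s \<longrightarrow>
        distributed M lborel (\<lambda>\<omega>. B s \<omega> - B r \<omega>) (normal_density 0 (sqrt (s - r)))"
      using B unfolding brownian_motion_def by (elim conjE)
    from this[rule_format, of 0 t] t
    have "distributed M lborel (\<lambda>\<omega>. B t \<omega> - B 0 \<omega>) (normal_density 0 (sqrt t))" by simp
    from distributed_integral[OF this, of "\<lambda>s. w \<bar>s\<bar>"]
    have "half_normal_mean w t = (\<integral>\<omega>. w \<bar>B t \<omega> - B 0 \<omega>\<bar> \<partial>M)"
      unfolding half_normal_mean_eq_integral_normal_density[OF t] by (simp add: w_meas)
    also have "\<dots> = (\<integral>\<omega>. w \<bar>B t \<omega>\<bar> \<partial>M)"
    proof (rule integral_cong_AE)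
      show "AE \<omega> in M. w \<bar>B t \<omega> - B 0 \<omega>\<bar> = w \<bar>B t \<omega>\<bar>" using B0 by eventually_elim simp
    qed (use t in \<open>simp_all add: comp meas borel_measurable_diff\<close>)
    finally show ?thesis by simp
  qed
qed

section \<open>The transition semigroup\<close>

locale lattice_walk = prob_space M
  for M :: "'w measure" and \<delta> :: real
    and S :: "real ^ 'd \<Rightarrow> real \<Rightarrow> 'w \<Rightarrow> real ^ 'd" +
  assumes walk: "symmetric_random_walk M \<delta> S"
begin

abbreviation "L \<equiv> scaled_lattice \<delta> :: (real ^ 'd) set"
abbreviation "P \<equiv> transition_operator M S"
abbreviation "Lap \<equiv> discrete_laplacian \<delta> :: (real ^ 'd \<Rightarrow> real) \<Rightarrow> _"

lemma
  assumes "x \<in> L"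
  shows walk_measurable: "t \<ge> 0 \<Longrightarrow> S x t \<in> borel_measurable M"
    and walk_in_lattice: "t \<ge> 0 \<Longrightarrow> \<omega> \<in> space M \<Longrightarrow> S x t \<omega> \<in> L"
    and walk_cadlag: "\<omega> \<in> space M \<Longrightarrow> cadlag (\<lambda>t. S x t \<omega>)"
    and walk_start: "AE \<omega> in M. S x 0 \<omega> = x"
  using walk assms unfolding symmetric_random_walk_def by blast+

text \<open>No regularity of \<open>f\<close> is required: the walk takes values in a countable set,
  on which every function is measurable.\<close>

lemma measurable_walk:
  fixes f :: "real ^ 'd \<Rightarrow> real"
  assumes "x \<in> L" "t \<ge> 0"
  shows "(\<lambda>\<omega>. f (S x t \<omega>)) \<in> borel_measurable M"
proof -
  have "S x t \<in> measurable M (count_space L)"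
    using walk_in_lattice[OF assms] walk_measurable[OF assms]
    by (subst measurable_count_space_eq_countable[OF countable_scaled_lattice])
       (auto intro: measurable_sets_borel)
  then show ?thesis by (rule measurable_compose) simp
qed

lemma integrable_walk:
  fixes f :: "real ^ 'd \<Rightarrow> real"
  assumes "bounded (f ` L)" "x \<in> L" "t \<ge> 0"
  shows "integrable M (\<lambda>\<omega>. f (S x t \<omega>))"
proof -
  obtain K where "\<And>x. x \<in> L \<Longrightarrow> \<bar>f x\<bar> \<le> K"
    using assms(1) by (auto simp: bounded_iff)
  then show ?thesis
    using walk_in_lattice[OF assms(2,3)]
    by (intro integrable_const_bound[of _ K] measurable_walk assms) auto
qed

text \<open>The contraction property: a bound that is uniform on the lattice survives averaging,
  with a constant independent of time.\<close>

lemma transition_bound: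
  assumes "\<And>y. y \<in> L \<Longrightarrow> \<bar>f y\<bar> \<le> K" "x \<in> L" "t \<ge> 0"
  shows "\<bar>P t f x\<bar> \<le> K"
proof -
  have "bounded (f ` L)" using assms(1) by (auto simp: bounded_iff)
  then have int: "integrable M (\<lambda>\<omega>. f (S x t \<omega>))" using assms by (intro integrable_walk)
  have "\<bar>P t f x\<bar> \<le> (\<integral>\<omega>. \<bar>f (S x t \<omega>)\<bar> \<partial>M)"
    unfolding transition_operator_def by (rule integral_abs_bound)
  also have "\<dots> \<le> (\<integral>\<omega>. K \<partial>M)"
    using int assms walk_in_lattice by (intro integral_mono) auto
  finally show ?thesis by (simp add: prob_space)
qed

lemma bounded_transition:
  assumes "bounded (f ` L)" "t \<ge> 0"
  shows "bounded (P t f ` L)"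
proof -
  obtain K where "\<And>x. x \<in> L \<Longrightarrow> \<bar>f x\<bar> \<le> K"
    using assms(1) by (auto simp: bounded_iff)
  then show ?thesis
    using transition_bound[of f K _ t] assms(2) by (auto simp: bounded_iff)
qed

text \<open>Take expectations in the Markov property; a conditional expectation has the same
  integral as the variable itself.\<close>

lemma transition_add:
  assumes f: "bounded (f ` L)" and x: "x \<in> L" and st: "s \<ge> 0" "t \<ge> 0"
  shows "P (s + t) f x = P s (P t f) x"
proof -
  let ?F = "process_sigma M (S x) {0..s}"
  interpret finite_measure_subalgebra M ?F
    by unfold_locales (rule subalgebra_process_sigma, use x walk_measurable in auto)
  have "AE \<omega> in M. real_cond_exp M ?F (\<lambda>\<omega>. f (S x (s + t) \<omega>)) \<omega> = P t f (S x s \<omega>)"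
    using walk f x st unfolding symmetric_random_walk_def by blast
  then have "(\<integral>\<omega>. real_cond_exp M ?F (\<lambda>\<omega>. f (S x (s + t) \<omega>)) \<omega> \<partial>M) = (\<integral>\<omega>. P t f (S x s \<omega>) \<partial>M)"
    by (intro integral_cong_AE measurable_walk) (use x st in auto)
  then show ?thesis
    using real_cond_exp_int(2)[OF integrable_walk[OF f x]] st
    by (simp add: transition_operator_def)
qed

lemma transition_zero:
  assumes "x \<in> L"
  shows "P 0 f x = f x"
proof -
  have "P 0 f x = (\<integral>\<omega>. f x \<partial>M)"
    unfolding transition_operator_def
    by (rule integral_cong_AE) (use walk_start[OF assms] measurable_walk[OF assms] in auto)
  then show ?thesis by (simp add: prob_space)
qed

section \<open>Differentiability of the semigroup\<close>

text \<open>The uniform generator limit with the division cleared, so that \<open>h = 0\<close> is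
  covered as well.\<close>

lemma transition_small_time:
  assumes f: "bounded (f ` L)" and "\<epsilon> > 0"
  obtains d where "d > 0"
    and "\<And>h x. 0 \<le> h \<Longrightarrow> h < d \<Longrightarrow> x \<in> L \<Longrightarrow> \<bar>P h f x - f x - h * (1/2 * Lap f x)\<bar> \<le> \<epsilon> * h"
proof -
  have "uniform_limit L (\<lambda>t x. (P t f x - f x) / t) (\<lambda>x. 1 / 2 * Lap f x) (at_right 0)"
    using walk f unfolding symmetric_random_walk_def by blast
  from uniform_limitD[OF this \<open>\<epsilon> > 0\<close>]
  obtain d where d: "d > 0"
    and *: "\<And>h x. 0 < h \<Longrightarrow> h < d \<Longrightarrow> x \<in> L \<Longrightarrow> \<bar>(P h f x - f x) / h - 1 / 2 * Lap f x\<bar> < \<epsilon>"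
    by (auto simp: eventually_at_right_field dist_real_def)
  have "\<bar>P h f x - f x - h * (1/2 * Lap f x)\<bar> \<le> \<epsilon> * h" if "0 \<le> h" "h < d" "x \<in> L" for h x
  proof (cases "h = 0")
    case False
    then have "P h f x - f x - h * (1/2 * Lap f x) = h * ((P h f x - f x) / h - 1 / 2 * Lap f x)"
      by (simp add: field_simps)
    then show ?thesis
      using *[of h x] that False by (simp add: abs_mult mult.commute[of \<epsilon>])
  qed (simp add: transition_zero that)
  with d that show ?thesis by blast
qed

text \<open>Apply \<open>P s\<close> to the small-time estimate. By contraction the same
  \<open>d\<close> works for every starting time \<open>s\<close>, which the left derivative below
  relies on.\<close>

lemma transition_step:
  assumes f: "bounded (f ` L)" and "\<epsilon> > 0"
  obtains d where "d > 0"
    and "\<And>s h x. 0 \<le> s \<Longrightarrow> 0 \<le> h \<Longrightarrow> h < d \<Longrightarrow> x \<in> L \<Longrightarrow>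
      \<bar>P (s + h) f x - P s f x - h * (1/2 * P s (Lap f) x)\<bar> \<le> \<epsilon> * h"
proof -
  obtain d where d: "d > 0"
    and *: "\<And>h x. 0 \<le> h \<Longrightarrow> h < d \<Longrightarrow> x \<in> L \<Longrightarrow> \<bar>P h f x - f x - h * (1/2 * Lap f x)\<bar> \<le> \<epsilon> * h"
    using transition_small_time[OF assms] by blast
  have "\<bar>P (s + h) f x - P s f x - h * (1/2 * P s (Lap f) x)\<bar> \<le> \<epsilon> * h"
    if s: "0 \<le> s" and h: "0 \<le> h" "h < d" and x: "x \<in> L" for s h x
  proof -
    have "P (s + h) f x - P s f x - h * (1/2 * P s (Lap f) x)
        = P s (\<lambda>y. P h f y - f y - h * (1/2 * Lap f y)) x"
      unfolding transition_add[OF f x s h(1)]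
      using integrable_walk[OF bounded_transition[OF f h(1)] x s] integrable_walk[OF f x s]
        integrable_walk[OF bounded_discrete_laplacian[OF f] x s]
      by (simp add: transition_operator_def)
    then show ?thesis
      using transition_bound[of _ "\<epsilon> * h", OF *[OF h] x s] by simp
  qed
  with d that show ?thesis by blast
qed

text \<open>Forward increments are the step estimate at \<open>s\<close>. A backward increment is a
  forward step from the earlier time \<open>y\<close>, with the slope at \<open>y\<close> in place
  of the slope at \<open>s\<close>; the two slopes are close because \<open>P s (Lap f) x\<close> is
  Lipschitz in \<open>s\<close>.\<close>

lemma transition_deriv:
  assumes f: "bounded (f ` L)" and x: "x \<in> L" and s: "s \<ge> 0"
  shows "((\<lambda>s. P s f x) has_real_derivative 1/2 * P s (Lap f) x) (at s within {0..})"
  unfolding has_field_derivative_def has_derivative_within_alt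
proof (intro conjI allI impI)
  show "bounded_linear ((*) (1/2 * P s (Lap f) x))" by (rule bounded_linear_mult_right)
  fix e :: real assume e: "e > 0"
  let ?g = "Lap f"
  have g: "bounded (?g ` L)" by (rule bounded_discrete_laplacian[OF f])
  obtain K where K: "\<And>y. y \<in> L \<Longrightarrow> \<bar>Lap ?g y\<bar> \<le> K"
    using bounded_discrete_laplacian[OF g] by (auto simp: bounded_iff)
  then have K0: "K \<ge> 0" using x by force
  obtain d1 where d1: "d1 > 0"
    and A1: "\<And>s h x. 0 \<le> s \<Longrightarrow> 0 \<le> h \<Longrightarrow> h < d1 \<Longrightarrow> x \<in> L \<Longrightarrow>
      \<bar>P (s + h) f x - P s f x - h * (1/2 * P s ?g x)\<bar> \<le> e / 2 * h"
    using transition_step[OF f, of "e/2"] e by auto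
  obtain d2 where d2: "d2 > 0"
    and A2: "\<And>s h x. 0 \<le> s \<Longrightarrow> 0 \<le> h \<Longrightarrow> h < d2 \<Longrightarrow> x \<in> L \<Longrightarrow>
      \<bar>P (s + h) ?g x - P s ?g x - h * (1/2 * P s (Lap ?g) x)\<bar> \<le> 1 * h"
    using transition_step[OF g, of 1] by auto
  \<comment> \<open>The tolerance \<open>1\<close> in the second estimate gives \<open>Lap f\<close>
    the Lipschitz constant \<open>K + 1\<close> along the semigroup; the bound
    \<open>e / (K + 1)\<close> makes the change of slope at most \<open>e\<close>.\<close>
  define d where "d = min (min d1 d2) (e / (K + 1))"
  have "d > 0" using d1 d2 e K0 by (simp add: d_def)
  moreover have "\<bar>P y f x - P s f x - 1/2 * P s ?g x * (y - s)\<bar> \<le> e * \<bar>y - s\<bar>"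
    if y: "y \<ge> 0" "\<bar>y - s\<bar> < d" for y
  proof (cases "y \<ge> s")
    case True
    then have "\<bar>P y f x - P s f x - (y - s) * (1/2 * P s ?g x)\<bar> \<le> e / 2 * (y - s)"
      using A1[of s "y - s" x] s x y by (simp add: d_def)
    also have "\<dots> \<le> e * \<bar>y - s\<bar>" using True e by (simp add: mult_right_mono)
    finally show ?thesis by (simp add: mult.commute)
  next
    case False
    \<comment> \<open>The step from \<open>y\<close> costs \<open>e / 2 * h\<close>, and half the
      change of \<open>P (Lap f)\<close> between \<open>y\<close> and \<open>s\<close>, times
      \<open>h\<close>, costs another \<open>e / 2 * h\<close>.\<close>
    define h where "h = s - y"
    have h: "h > 0" "h < d1" "h < d2" "h < e / (K + 1)" "s = y + h"
      using False y by (auto simp: h_def d_def)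
    have 1: "\<bar>P s f x - P y f x - h * (1/2 * P y ?g x)\<bar> \<le> e / 2 * h"
      using A1[of y h x] h y x by simp
    have "\<bar>P s ?g x - P y ?g x - h * (1/2 * P y (Lap ?g) x)\<bar> \<le> h"
      using A2[of y h x] h y x by simp
    moreover have "\<bar>h * (1/2 * P y (Lap ?g) x)\<bar> \<le> h * K"
      using transition_bound[of "Lap ?g" K, OF K x y(1)] h by (simp add: abs_mult)
    ultimately have "\<bar>P s ?g x - P y ?g x\<bar> \<le> h * (K + 1)"
      by (simp add: algebra_simps)
    also have "\<dots> \<le> e" using h(4) K0 by (simp add: field_simps)
    finally have "\<bar>h * (1/2 * (P s ?g x - P y ?g x))\<bar> \<le> h * (e / 2)"
      using h(1) by (simp add: abs_mult)
    then have "\<bar>P s f x - P y f x - h * (1/2 * P s ?g x)\<bar> \<le> e * h"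
      using 1 unfolding right_diff_distrib mult.left_commute[of h] by argo
    moreover have "P y f x - P s f x - 1/2 * P s ?g x * (y - s)
        = - (P s f x - P y f x - h * (1/2 * P s ?g x))"
      by (simp add: h_def field_simps)
    moreover have "\<bar>y - s\<bar> = h" using h(1) by (simp add: h_def)
    ultimately show ?thesis by (simp only: abs_minus_cancel)
  qed
  ultimately show "\<exists>d>0. \<forall>y\<in>{0..}. norm (y - s) < d \<longrightarrow>
      norm (P y f x - P s f x - 1/2 * P s (Lap f) x * (y - s)) \<le> e * norm (y - s)"
    by auto
qed

lemma continuous_on_transition:
  assumes "bounded (f ` L)" "x \<in> L"
  shows "continuous_on {0..} (\<lambda>s. P s f x)"
  using transition_deriv[OF assms]
  by (auto simp: continuous_on_eq_continuous_within intro: DERIV_continuous)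

text \<open>Both sides are twice the right derivative at \<open>0\<close> of \<open>h \<mapsto> P (s + h) f x\<close>.\<close>

lemma laplacian_transition:
  assumes f: "bounded (f ` L)" and x: "x \<in> L" and s: "s \<ge> 0"
  shows "Lap (P s f) x = P s (Lap f) x"
proof -
  have "((\<lambda>h. P h (P s f) x) has_real_derivative 1/2 * Lap (P s f) x) (at 0 within {0..})"
    using transition_deriv[OF bounded_transition[OF f s] x order.refl] by (simp add: transition_zero x)
  moreover have "((\<lambda>h. P (s + h) f x) has_real_derivative 1/2 * P s (Lap f) x) (at 0 within {0..})"
  proof -
    \<comment> \<open>The chain rule for the shift by \<open>s\<close> needs the derivative only
      within the image of \<open>{0..}\<close>, that is to the right of \<open>s\<close>.\<close>
    have "((\<lambda>y. P y f x) has_real_derivative 1/2 * P s (Lap f) x) (at (s + 0) within (+) s ` {0..})"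
      by (rule DERIV_subset[of _ _ _ "{0..}"]) (use transition_deriv[OF f x s] s in auto)
    moreover have "((+) s has_real_derivative 1) (at 0 within {0..})"
      by (auto intro!: derivative_eq_intros)
    ultimately show ?thesis
      using DERIV_image_chain by (fastforce simp: o_def)
  qed
  then have "((\<lambda>h. P h (P s f) x) has_real_derivative 1/2 * P s (Lap f) x) (at 0 within {0..})"
    by (rule has_field_derivative_transform_within[OF _ zero_less_one]) (auto simp: transition_add[symmetric] f x s add.commute)
  ultimately have "1/2 * Lap (P s f) x = 1/2 * P s (Lap f) x"
    unfolding has_field_derivative_iff
    by (intro tendsto_unique) (auto simp: at_within_Ici_at_right)
  then show ?thesis by simp
qed

section \<open>Gaussian averages of the semigroup\<close>

text \<open>The half-line results with \<open>w s = P s f x\<close>. Each derivative brings a factor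
  \<open>1/2\<close> from the generator: the boundary term becomes \<open>1/2\<close> over
  \<open>sqrt (2 * pi * t)\<close>, which is \<open>1 / sqrt (8 * pi * t)\<close>, and the mean of
  \<open>w''\<close> is halved, turning \<open>1/4\<close> into \<open>1/8\<close>.\<close>

lemma
  assumes f: "bounded (f ` L)" and x: "x \<in> L"
  shows transition_integrable_normal: "t \<ge> 0 \<Longrightarrow>
      integrable lborel (\<lambda>z. std_normal_density z * P (sqrt t * \<bar>z\<bar>) f x)"
    and continuous_on_mean_transition: "continuous_on {0..} (half_normal_mean (\<lambda>s. P s f x))"
    and deriv_mean_transition: "t > 0 \<Longrightarrow>
      (half_normal_mean (\<lambda>s. P s f x) has_real_derivative
        Lap f x / sqrt (8 * pi * t) + 1/8 * half_normal_mean (\<lambda>s. P s (Lap (Lap f)) x) t) (at t)"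
proof -
  note f' = bounded_discrete_laplacian[OF f]
  note f'' = bounded_discrete_laplacian[OF f']
  note cont = continuous_on_transition[OF _ x]
  have bd: "\<exists>K. \<forall>s\<ge>0. \<bar>P s g x\<bar> \<le> K" if "bounded (g ` L)" for g
  proof -
    from that obtain a where "\<And>y. y \<in> L \<Longrightarrow> \<bar>g y\<bar> \<le> a" by (auto simp: bounded_iff)
    then show ?thesis using transition_bound[OF _ x] by blast
  qed
  obtain K K' K'' where K: "\<And>s. s \<ge> 0 \<Longrightarrow> \<bar>P s f x\<bar> \<le> K" "\<And>s. s \<ge> 0 \<Longrightarrow> \<bar>1/2 * P s (Lap f) x\<bar> \<le> K'"
    "\<And>s. s \<ge> 0 \<Longrightarrow> \<bar>1/4 * P s (Lap (Lap f)) x\<bar> \<le> K''"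
  proof -
    from bd[OF f] bd[OF f'] bd[OF f''] obtain K0 K1 K2 where
      "\<forall>s\<ge>0. \<bar>P s f x\<bar> \<le> K0" "\<forall>s\<ge>0. \<bar>P s (Lap f) x\<bar> \<le> K1" "\<forall>s\<ge>0. \<bar>P s (Lap (Lap f)) x\<bar> \<le> K2"
      by blast
    then show thesis
      by (intro that[of K0 "1/2 * K1" "1/4 * K2"]) (auto simp: abs_mult)
  qed
  show "integrable lborel (\<lambda>z. std_normal_density z * P (sqrt t * \<bar>z\<bar>) f x)" if "t \<ge> 0"
    using integrable_std_normal_bounded[OF cont[OF f] K(1), of "sqrt t" 0] that by simp
  show "continuous_on {0..} (half_normal_mean (\<lambda>s. P s f x))"
    by (rule continuous_on_half_normal_mean[OF cont[OF f] K(1)])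
  show "(half_normal_mean (\<lambda>s. P s f x) has_real_derivative
      Lap f x / sqrt (8 * pi * t) + 1/8 * half_normal_mean (\<lambda>s. P s (Lap (Lap f)) x) t) (at t)" if t: "t > 0"
  proof -
    have "((\<lambda>s. 1/2 * P s (Lap f) x) has_real_derivative 1/4 * P s (Lap (Lap f)) x) (at s within {0..})"
      if "s \<ge> 0" for s
      using DERIV_cmult[OF transition_deriv[OF f' x that], of "1/2"] by simp
    moreover have "continuous_on {0..} (\<lambda>s. 1/4 * P s (Lap (Lap f)) x)"
      by (intro continuous_on_mult_left cont f'')
    ultimately    have "(half_normal_mean (\<lambda>s. P s f x) has_real_derivative
        1/2 * P 0 (Lap f) x / sqrt (2 * pi * t)
        + half_normal_mean (\<lambda>s. 1/4 * P s (Lap (Lap f)) x) t / 2) (at t)"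
      by (intro has_real_derivative_half_normal_mean[OF transition_deriv[OF f x] _ _ K t])
    moreover have "half_normal_mean (\<lambda>s. 1/4 * P s (Lap (Lap f)) x) t
        = 1/4 * half_normal_mean (\<lambda>s. P s (Lap (Lap f)) x) t"
      unfolding half_normal_mean_def by simp
    moreover have "sqrt (8 * pi * t) = 2 * sqrt (2 * pi * t)"
      using real_sqrt_mult[of 4 "2 * pi * t"] by (simp add: mult.assoc)
    ultimately show ?thesis
      by (simp only: transition_zero[OF x]) simp
  qed
qed

text \<open>The Laplacian is a finite sum of integrable terms, so it passes under the Gaussian
  integral, where it commutes with the semigroup.\<close>

lemma laplacian_mean_transition:
  assumes f: "bounded (f ` L)" and x: "x \<in> L" and t: "t \<ge> 0"
  shows "Lap (\<lambda>x. half_normal_mean (\<lambda>s. P s f x) t) x = half_normal_mean (\<lambda>s. P s (Lap f) x) t"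
proof -
  note int = transition_integrable_normal[OF f _ t]
  note steps = scaled_lattice_step[OF x]
  have "half_normal_mean (\<lambda>s. P s (Lap f) x) t
      = (\<integral>z. std_normal_density z * Lap (P (sqrt t * \<bar>z\<bar>) f) x \<partial>lborel)"
    unfolding half_normal_mean_def using t by (simp add: laplacian_transition f x)
  also have "\<dots> = (\<integral>z. (\<Sum>i\<in>UNIV. (std_normal_density z * P (sqrt t * \<bar>z\<bar>) f (x + \<delta> *\<^sub>R axis i 1)
      - 2 * (std_normal_density z * P (sqrt t * \<bar>z\<bar>) f x)
      + std_normal_density z * P (sqrt t * \<bar>z\<bar>) f (x - \<delta> *\<^sub>R axis i 1)) / \<delta>\<^sup>2) \<partial>lborel)"
    unfolding discrete_laplacian_def sum_distrib_left
    by (intro Bochner_Integration.integral_cong refl sum.cong)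
       (simp add: algebra_simps)
  also have "\<dots> = Lap (\<lambda>x. half_normal_mean (\<lambda>s. P s f x) t) x"
    unfolding discrete_laplacian_def half_normal_mean_def
    using int[OF x] int[OF steps(1)] int[OF steps(2)] by (simp add: Bochner_Integration.integral_sum)
  finally show ?thesis by simp
qed

text \<open>Serves both halves of the theorem. Boundedness on the lattice is all that is asked of
  \<open>f\<close>, so an indicator qualifies, and \<open>f\<^sub>0\<close> and \<open>u\<close> are
  compared with the formulas only at lattice points and nonnegative times.\<close>

lemma solves_btrw_equation_mean:
  assumes f: "bounded (f ` L)" and f0: "\<And>x. x \<in> L \<Longrightarrow> f\<^sub>0 x = f x"
    and u: "\<And>t x. t \<ge> 0 \<Longrightarrow> x \<in> L \<Longrightarrow> u t x = half_normal_mean (\<lambda>s. P s f x) t"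
  shows "solves_btrw_equation \<delta> f\<^sub>0 u"
  unfolding solves_btrw_equation_def
proof (intro conjI allI impI ballI)
  fix t :: real and x :: "real ^ 'd" assume t: "t > 0" and x: "x \<in> L"
  have Lap_u: "Lap (u t) y = half_normal_mean (\<lambda>s. P s (Lap f) y) t" if "y \<in> L" for y
    using discrete_laplacian_cong[OF u that] laplacian_mean_transition[OF f that] t by simp
  have "Lap (Lap (u t)) x = half_normal_mean (\<lambda>s. P s (Lap (Lap f)) x) t"
    using discrete_laplacian_cong[OF Lap_u x]
      laplacian_mean_transition[OF bounded_discrete_laplacian[OF f] x] t by simp
  moreover have "Lap f\<^sub>0 x = Lap f x"
    by (rule discrete_laplacian_cong[OF f0 x])
  ultimately have "(half_normal_mean (\<lambda>s. P s f x) has_real_derivative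
      Lap f\<^sub>0 x / sqrt (8 * pi * t) + 1/8 * Lap (Lap (u t)) x) (at t)"
    using deriv_mean_transition[OF f x t] by simp
  then show "((\<lambda>s. u s x) has_real_derivative
      Lap f\<^sub>0 x / sqrt (8 * pi * t) + 1/8 * Lap (Lap (u t)) x) (at t)"
    \<comment> \<open>\<open>u\<close> is known only at nonnegative times; the open set
      \<open>{0<..}\<close> around \<open>t\<close> suffices for the derivative.\<close>
    by (rule has_field_derivative_transform_within_open[of _ _ _ "{0<..}"]) (use t x u in auto)
next
  fix x :: "real ^ 'd" assume x: "x \<in> L"
  show "u 0 x = f\<^sub>0 x"
    using u[OF _ x] f0[OF x] by (simp add: half_normal_mean_0 transition_zero x)
  show "continuous_on {0..} (\<lambda>t. u t x)"
    using continuous_on_mean_transition[OF f x] by (rule continuous_on_eq) (use u x in auto)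
qed

section \<open>The walk sampled at the Brownian clock\<close>

text \<open>
  Paths are only right-continuous, so the random time is approximated by grid times \<open>c n s\<close> strictly
  above it.
\<close>

lemma measurable_walk_random_time:
  fixes f :: "real ^ 'd \<Rightarrow> real"
  assumes f: "continuous_on UNIV f" and x: "x \<in> L"
  shows "(\<lambda>(s, \<omega>). f (S x \<bar>s\<bar> \<omega>)) \<in> borel_measurable (borel \<Otimes>\<^sub>M process_sigma M (S x) {0..})"
proof -
  let ?F = "process_sigma M (S x) {0..}"
  define k where "k n s = nat \<lfloor>real (Suc n) * \<bar>s\<bar>\<rfloor>" for n and s :: real
  define c where "c n s = real (k n s + 1) / real (Suc n)" for n s
  have k: "real (k n s) \<le> real (Suc n) * \<bar>s\<bar>" "real (Suc n) * \<bar>s\<bar> < real (k n s) + 1" for n s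
  proof -
    have "real (k n s) = of_int \<lfloor>real (Suc n) * \<bar>s\<bar>\<rfloor>" by (simp add: k_def)
    then show "real (k n s) \<le> real (Suc n) * \<bar>s\<bar>" "real (Suc n) * \<bar>s\<bar> < real (k n s) + 1"
      by linarith+
  qed
  have c_gt: "\<bar>s\<bar> < c n s" for n s
    using k(2)[of n s] unfolding c_def by (simp add: pos_less_divide_eq mult.commute)
  have c_le: "c n s \<le> \<bar>s\<bar> + inverse (real (Suc n))" for n s
  proof -
    have "c n s = real (k n s) / real (Suc n) + inverse (real (Suc n))"
      by (simp add: c_def add_divide_distrib inverse_eq_divide)
    also have "real (k n s) / real (Suc n) \<le> \<bar>s\<bar>"
      using k(1)[of n s] by (simp add: pos_divide_le_eq mult.commute)
    finally show ?thesis by simp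
  qed
  have c_lim: "(\<lambda>n. c n s) \<longlonglongrightarrow> \<bar>s\<bar>" for s
  proof (rule real_tendsto_sandwich)
    show "\<forall>\<^sub>F n in sequentially. \<bar>s\<bar> \<le> c n s"
      by (intro always_eventually allI less_imp_le c_gt)
    show "\<forall>\<^sub>F n in sequentially. c n s \<le> \<bar>s\<bar> + inverse (real (Suc n))"
      by (intro always_eventually allI c_le)
    show "(\<lambda>n. \<bar>s\<bar> + inverse (real (Suc n))) \<longlonglongrightarrow> \<bar>s\<bar>"
      by (rule LIMSEQ_inverse_real_of_nat_add)
  qed (rule tendsto_const)
  show ?thesis
  proof (rule borel_measurable_LIMSEQ_real)
    fix n
    \<comment> \<open>For a fixed index \<open>j\<close> the time is deterministic. The random index
      \<open>k n\<close> takes countably many values, so it can then be substituted for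
      \<open>j\<close> measurably.\<close>
    have "(\<lambda>p. f (S x (real (j + 1) / real (Suc n)) (snd p))) \<in> borel_measurable (borel \<Otimes>\<^sub>M ?F)" for j
    proof -
      have "S x (real (j + 1) / real (Suc n)) \<in> measurable ?F borel"
        by (rule measurable_process_sigma) simp
      then show ?thesis
        using borel_measurable_continuous_onI[OF f] by measurable
    qed
    moreover have "(\<lambda>p. k n (fst p)) \<in> measurable (borel \<Otimes>\<^sub>M ?F) (count_space UNIV)"
      unfolding k_def by measurable
    ultimately have "(\<lambda>p. f (S x (real (k n (fst p) + 1) / real (Suc n)) (snd p)))
        \<in> borel_measurable (borel \<Otimes>\<^sub>M ?F)"
      by (rule measurable_compose_countable)
    then show "(\<lambda>p. f (S x (c n (fst p)) (snd p))) \<in> borel_measurable (borel \<Otimes>\<^sub>M ?F)"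
      by (simp add: c_def)
  next
    fix p assume "p \<in> space ((borel :: real measure) \<Otimes>\<^sub>M ?F)"
    then obtain s \<omega> where p: "p = (s, \<omega>)" and \<omega>: "\<omega> \<in> space M"
      by (auto simp: space_pair_measure)
    have "continuous (at_right \<bar>s\<bar>) (\<lambda>t. S x t \<omega>)"
      using walk_cadlag[OF x \<omega>] by (simp add: cadlag_def)
    then have "((\<lambda>t. S x t \<omega>) \<longlongrightarrow> S x \<bar>s\<bar> \<omega>) (at_right \<bar>s\<bar>)"
      by (simp add: continuous_within)
    moreover have "filterlim (\<lambda>n. c n s) (at_right \<bar>s\<bar>) sequentially"
    proof (unfold filterlim_at, intro conjI always_eventually allI c_lim)
      show "c n s \<in> {\<bar>s\<bar><..}" "c n s \<noteq> \<bar>s\<bar>" for n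
        using c_gt[of s n] by auto
    qed
    ultimately have "(\<lambda>n. S x (c n s) \<omega>) \<longlonglongrightarrow> S x \<bar>s\<bar> \<omega>"
      by (rule filterlim_compose)
    then have "(\<lambda>n. f (S x (c n s) \<omega>)) \<longlonglongrightarrow> f (S x \<bar>s\<bar> \<omega>)"
      using continuous_on_tendsto_compose[OF f] by auto
    then show "(\<lambda>n. f (S x (c n (fst p)) (snd p))) \<longlonglongrightarrow> (case p of (s, \<omega>) \<Rightarrow> f (S x \<bar>s\<bar> \<omega>))"
      by (simp add: p)
  qed
qed

text \<open>Fubini on the product law of \<open>B t\<close> and the walk: with the clock frozen at
  \<open>s\<close>, the inner integral is the semigroup at the deterministic time
  \<open>\<bar>s\<bar>\<close>. Continuity of \<open>f\<close> enters through joint measurability in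
  time and path.\<close>

lemma expectation_walk_independent_time:
  fixes f :: "real ^ 'd \<Rightarrow> real"
  assumes f: "continuous_on UNIV f" "bounded (range f)" and x: "x \<in> L" and t: "t \<ge> 0"
    and B: "B t \<in> borel_measurable M" and ind: "independent_processes M (S x) B"
  shows "(\<integral>\<omega>. f (btrw S B x t \<omega>) \<partial>M) = (\<integral>\<omega>. P \<bar>B t \<omega>\<bar> f x \<partial>M)"
proof -
  let ?F = "process_sigma M (S x) {0..}" and ?id = "\<lambda>\<omega>::'w. \<omega>"
  let ?D = "distr M borel (B t)" and ?E = "distr M ?F ?id"
  let ?h = "\<lambda>(s, \<omega>). f (S x \<bar>s\<bar> \<omega>)"
  note h = measurable_walk_random_time[OF f(1) x]
  have id: "?id \<in> measurable M ?F"
    using walk_measurable[OF x] by (intro measurable_ident_subalgebra subalgebra_process_sigma) auto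
  have pair: "(\<lambda>\<omega>. (B t \<omega>, \<omega>)) \<in> measurable M (borel \<Otimes>\<^sub>M ?F)"
    using B id by (rule measurable_Pair)
  have prod: "?D \<Otimes>\<^sub>M ?E = distr M (borel \<Otimes>\<^sub>M ?F) (\<lambda>\<omega>. (B t \<omega>, \<omega>))"
    by (rule pair_measure_distr_process_sigma[OF prob_space_axioms ind t _ B])
       (rule walk_measurable[OF x])
  interpret D: prob_space ?D by (rule prob_space_distr[OF B])
  interpret E: prob_space ?E by (rule prob_space_distr[OF id])
  interpret DE: pair_prob_space ?D ?E ..
  obtain K where K: "\<And>y. \<bar>f y\<bar> \<le> K"
    using f(2) by (auto simp: bounded_iff)
  have int: "integrable (?D \<Otimes>\<^sub>M ?E) ?h"
  proof (rule DE.P.integrable_const_bound[of _ K])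
    show "?h \<in> borel_measurable (?D \<Otimes>\<^sub>M ?E)"
      using h unfolding prod by simp
  qed (use K in auto)
  have "(\<integral>\<omega>. f (btrw S B x t \<omega>) \<partial>M) = integral\<^sup>L (?D \<Otimes>\<^sub>M ?E) ?h"
    unfolding prod integral_distr[OF pair h] by (simp add: btrw_def)
  also have "\<dots> = (\<integral>s. (\<integral>\<omega>. f (S x \<bar>s\<bar> \<omega>) \<partial>?E) \<partial>?D)"
    using DE.integral_fst'[OF int] by simp
  also have "(\<lambda>s. \<integral>\<omega>. f (S x \<bar>s\<bar> \<omega>) \<partial>?E) = (\<lambda>s. P \<bar>s\<bar> f x)"
  proof
    fix s
    have "S x \<bar>s\<bar> \<in> measurable ?F borel"
      by (rule measurable_process_sigma) simp
    then have meas: "(\<lambda>\<omega>. f (S x \<bar>s\<bar> \<omega>)) \<in> borel_measurable ?F"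
      using borel_measurable_continuous_onI[OF f(1)] by measurable
    show "(\<integral>\<omega>. f (S x \<bar>s\<bar> \<omega>) \<partial>?E) = P \<bar>s\<bar> f x"
      unfolding integral_distr[OF id meas] transition_operator_def ..
  qed
  also have "(\<integral>s. P \<bar>s\<bar> f x \<partial>?D) = (\<integral>\<omega>. P \<bar>B t \<omega>\<bar> f x \<partial>M)"
  proof (rule integral_distr[OF B])
    have "bounded (f ` L)" using f(2) by (rule bounded_subset) auto
    from borel_measurable_half_line_scaled[OF continuous_on_transition[OF this x], of 1]
    show "(\<lambda>s. P \<bar>s\<bar> f x) \<in> borel_measurable borel" by simp
  qed
  finally show ?thesis .
qed

section \<open>Transition densities\<close>

lemma rw_density_eq_transition:
  assumes "x \<in> L" "t \<ge> 0"
  shows "rw_density M S t x y = P t (indicator {y}) x"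
proof -
  have "P t (indicator {y}) x = (\<integral>\<omega>. indicator {\<omega> \<in> space M. S x t \<omega> = y} \<omega> \<partial>M)"
    unfolding transition_operator_def
    by (intro Bochner_Integration.integral_cong) (auto simp: indicator_def)
  then show ?thesis by (simp add: rw_density_def Int_absorb2)
qed

text \<open>The integral clause is the half-line form of the mean, and the separate clause at
  \<open>t = 0\<close> agrees with it because the mean at time \<open>0\<close> is the value of the
  semigroup at \<open>0\<close>.\<close>

lemma btrw_density_eq_mean:
  assumes x: "x \<in> L" and t: "t \<ge> 0"
  shows "btrw_density M S t x y = half_normal_mean (\<lambda>s. P s (indicator {y}) x) t"
proof (cases "t = 0")
  case True
  then show ?thesis
    by (simp add: btrw_density_def half_normal_mean_0 rw_density_eq_transition x)
next
  case False
  have bd: "\<bar>P s (indicator {y}) x\<bar> \<le> 1" if "s \<ge> 0" for s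
    by (rule transition_bound[OF _ x that]) (simp add: indicator_def)
  have "bounded (indicator {y} ` L :: real set)"
    by (auto simp: bounded_iff indicator_def intro!: exI[of _ 1])
  note cont = continuous_on_transition[OF this x]
  have "(LBINT s:{0<..}. rw_density M S s x y * (exp (- s\<^sup>2 / (2 * t)) / sqrt (2 * pi * t)))
      = (LBINT s:{0<..}. P s (indicator {y}) x * (exp (- s\<^sup>2 / (2 * t)) / sqrt (2 * pi * t)))"
    by (intro set_lebesgue_integral_cong) (auto simp: rw_density_eq_transition x)
  then show ?thesis
    using half_normal_mean_eq_half_line[OF cont bd, of t] t False by (simp add: btrw_density_def)
qed

end

theorem lemma1p1:
  fixes \<delta> :: "nat \<Rightarrow> real" and n :: nat and \<gamma> :: real
    and u\<^sub>0 :: "real ^ 'd \<Rightarrow> real"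
    and M :: "'w measure"
    and S :: "real ^ 'd \<Rightarrow> real \<Rightarrow> 'w \<Rightarrow> real ^ 'd"
    and B :: "real \<Rightarrow> 'w \<Rightarrow> real"
  assumes "CARD('d) \<in> {1, 2, 3}"
    and "\<And>k. \<delta> k > 0"
    and "0 < \<gamma>" and "\<gamma> \<le> 1" and "u\<^sub>0 \<in> C_b_2 \<gamma>"
    and "prob_space M"
    and "symmetric_random_walk M (\<delta> n) S"
    and "brownian_motion M B"
    and "\<And>x. x \<in> scaled_lattice (\<delta> n) \<Longrightarrow> independent_processes M (S x) B"
  shows "solves_btrw_equation (\<delta> n) u\<^sub>0 (\<lambda>t x. \<integral>\<omega>. u\<^sub>0 (btrw S B x t \<omega>) \<partial>M)
    \<and> solves_btrw_equation (\<delta> n) (\<lambda>x. btrw_density M S 0 x 0) (\<lambda>t x. btrw_density M S t x 0)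
    \<and> (\<forall>x\<in>scaled_lattice (\<delta> n).
         btrw_density M S 0 x 0 = rw_density M S 0 x 0
         \<and> rw_density M S 0 x 0 = (if x = 0 then 1 else 0))"
proof -
  interpret prob_space M by fact
  interpret lattice_walk M "\<delta> n" S by unfold_locales fact
  \<comment> \<open>Continuity serves the sampling at the Brownian clock, boundedness the semigroup
    estimates.\<close>
  have cont: "continuous_on UNIV u\<^sub>0" and bd: "bounded (range u\<^sub>0)"
    using assms(5) unfolding C_b_2_def
    by (auto simp: continuous_on_eq_continuous_within intro: has_derivative_continuous)
  have bd': "bounded (u\<^sub>0 ` L)" using bd by (rule bounded_subset) auto
  have "solves_btrw_equation (\<delta> n) u\<^sub>0 (\<lambda>t x. \<integral>\<omega>. u\<^sub>0 (btrw S B x t \<omega>) \<partial>M)"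
  proof (rule solves_btrw_equation_mean[OF bd'])
    fix t :: real and x :: "real ^ 'd" assume t: "t \<ge> 0" and x: "x \<in> L"
    have "B t \<in> borel_measurable M" using assms(8) t by (simp add: brownian_motion_def)
    from expectation_walk_independent_time[where B = B, OF cont bd x t this assms(9)[OF x]]
    show "(\<integral>\<omega>. u\<^sub>0 (btrw S B x t \<omega>) \<partial>M) = half_normal_mean (\<lambda>s. P s u\<^sub>0 x) t"
      using brownian_motion_expectation_abs[OF assms(6,8) continuous_on_transition[OF bd' x] t]
      by simp
  qed simp
  \<comment> \<open>On the lattice the initial density is \<open>P 0\<close> applied to the
    indicator of the origin, hence that indicator itself; this identifies the initial function of
    the second equation.\<close>
  moreover have start: "btrw_density M S 0 x 0 = rw_density M S 0 x 0 \<and> rw_density M S 0 x 0 = indicator {0} x"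
    if "x \<in> L" for x
    using that by (simp add: btrw_density_def rw_density_eq_transition transition_zero)
  moreover have "solves_btrw_equation (\<delta> n) (\<lambda>x. btrw_density M S 0 x 0) (\<lambda>t x. btrw_density M S t x 0)"
  proof (rule solves_btrw_equation_mean)
    show "bounded (indicator {0 :: real ^ 'd} ` L :: real set)"
      by (auto simp: bounded_iff indicator_def intro!: exI[of _ 1])
  qed (use start btrw_density_eq_mean in auto)
  ultimately show ?thesis
    by (simp add: indicator_def)
qed

end
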